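(* For every two integers $s$ and $t$ with $2\leq s\leq t$, $$r(F_s,F_t)\geq 1+(s-1)\lfloor t/2\rfloor .$$
   Context: All graphs are finite and simple. For integers $k\geq 2$, $F_k$ is the graph with vertex set $\{v_i : 1\le i\le k\}$ and edge set $\{v_iv_j : 1\le i\le \lfloor k/2\rfloor,\ i+1\le j\le k+1-i\}$. For two graphs $G_1,G_2$, the Ramsey number $r(G_1,G_2)$ is the least positive integer $n$ such that for every graph $G$ of order $n$ (i.e. with $n$ vertices), either $G$ contains $G_1$ as a (not necessarily induced) subgraph or the complement $\overline{G}$ contains $G_2$ as a subgraph. *)

theory Defs
  imports "Graph_Theory.Graph_Theory"
begin

text \<open>
  Finite simple graphs are the \<^locale>\<open>pair_graph\<close>s of the library: finite, loop-free, and
  with a symmetric arc set, so that an edge \<open>uv\<close> is the pair of arcs \<open>(u, v)\<close> and \<open>(v, u)\<close>.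
\<close>

definition graph_complement :: "'a pair_pre_digraph \<Rightarrow> 'a pair_pre_digraph" where
  "graph_complement G =
     \<lparr> pverts = pverts G,
       parcs = {(u, v). u \<in> pverts G \<and> v \<in> pverts G \<and> u \<noteq> v \<and> (u, v) \<notin> parcs G} \<rparr>"

definition contains_subgraph :: "'a pair_pre_digraph \<Rightarrow> 'b pair_pre_digraph \<Rightarrow> bool" where
  "contains_subgraph G G1 \<longleftrightarrow>
     (\<exists>H :: 'a pair_pre_digraph.
        subgraph (with_proj H) (with_proj G) \<and> digraph_iso (with_proj G1) (with_proj H))"

text \<open>
  Quantifying over graphs whose vertices are natural numbers loses nothing, since every finite
  graph is isomorphic to one of these. The order of \<open>G\<close> is exactly \<open>n\<close>.
\<close>

definition ramsey_number :: "'a pair_pre_digraph \<Rightarrow> 'b pair_pre_digraph \<Rightarrow> nat" where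
  "ramsey_number G1 G2 =
     (LEAST n. 0 < n \<and>
        (\<forall>G :: nat pair_pre_digraph. pair_graph G \<and> card (pverts G) = n \<longrightarrow>
           contains_subgraph G G1 \<or> contains_subgraph (graph_complement G) G2))"

text \<open>The vertex \<open>v\<^sub>i\<close> is represented by the number \<open>i\<close>.\<close>

definition F_edges :: "nat \<Rightarrow> (nat \<times> nat) set" where
  "F_edges k = {(i, j). 1 \<le> i \<and> i \<le> k div 2 \<and> i + 1 \<le> j \<and> j \<le> k + 1 - i}"

definition F_graph :: "nat \<Rightarrow> nat pair_pre_digraph" where
  "F_graph k = \<lparr> pverts = {1..k}, parcs = F_edges k \<union> (F_edges k)\<inverse> \<rparr>"

lemma pair_graph_graph_complement:
  assumes "pair_graph G"
  shows "pair_graph (graph_complement G)"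
proof -
  interpret G: pair_graph G by fact
  have sym: "(u, v) \<in> parcs G \<longleftrightarrow> (v, u) \<in> parcs G" for u v
    using G.pair_sym_arcs by (auto simp: symmetric_def dest: symD)
  have "parcs (graph_complement G) \<subseteq> pverts G \<times> pverts G"
    by (auto simp: graph_complement_def)
  then have "finite (parcs (graph_complement G))"
    using G.pair_finite_verts by (meson finite_SigmaI finite_subset)
  then show ?thesis
    using G.pair_finite_verts sym
    by unfold_locales (auto simp: graph_complement_def symmetric_def intro!: symI)
qed

lemma pair_graph_F_graph: "pair_graph (F_graph k)"
proof -
  have sub: "parcs (F_graph k) \<subseteq> {1..k} \<times> {1..k}"
    by (auto simp: F_graph_def F_edges_def)
  then have "finite (parcs (F_graph k))"
    by (meson finite_SigmaI finite_atLeastAtMost finite_subset)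
  with sub show ?thesis
    by unfold_locales (auto simp: F_graph_def F_edges_def symmetric_def intro!: symI)
qed

end

theory Submission
  imports Defs "HOL-Library.Ramsey"
begin

text \<open>
  The bound is the Chvatal--Harary construction. The graph \<open>F\<^sub>s\<close> is connected on \<open>s\<close> vertices,
  since \<open>v\<^sub>1\<close> is adjacent to all others, and \<open>F\<^sub>t\<close> contains a clique on \<open>t div 2 + 1\<close> vertices,
  namely its first \<open>t div 2 + 1\<close> ones. For \<open>n \<le> (s - 1) * (t div 2)\<close>, let \<open>G\<close> be a disjoint union
  of at most \<open>t div 2\<close> cliques, each on at most \<open>s - 1\<close> vertices, with \<open>n\<close> vertices in all
  (\<open>block_graph\<close>). A connected subgraph of \<open>G\<close> stays inside one clique, which is too small for
  \<open>F\<^sub>s\<close>; a clique of the complement meets each block at most once, and there are too few blocks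
  for \<open>F\<^sub>t\<close>.

  The Ramsey number is a least element, so these examples bound it from below only once some \<open>n\<close>
  is known to satisfy the defining property. This is Ramsey's theorem for two colours
  (\<open>ramsey_number_exists\<close>): a sufficiently large clique contains any given graph.
\<close>

section \<open>Subgraph containment as embedding\<close>

text \<open>
  In a digraph whose arcs are pairs, an isomorphism is forced to act on arcs through its action on
  vertices, so only a vertex map has to be given.
\<close>

lemma contains_subgraph_iff_embedding:
  assumes G: "pair_wf_digraph G" and G1: "pair_wf_digraph G1"
  shows "contains_subgraph G G1 \<longleftrightarrow>
    (\<exists>f. inj_on f (pverts G1) \<and> f ` pverts G1 \<subseteq> pverts G \<and>
         (\<forall>u v. (u, v) \<in> parcs G1 \<longrightarrow> (f u, f v) \<in> parcs G))"
proof
  assume "contains_subgraph G G1"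
  then obtain H h where sub: "subgraph (with_proj H) (with_proj G)"
    and iso: "pre_digraph.digraph_isomorphism (with_proj G1) h"
    and H: "with_proj H = app_iso h (with_proj G1)"
    unfolding contains_subgraph_def digraph_iso_def by blast
  let ?f = "iso_verts h"
  have H_eqs: "pverts H = ?f ` pverts G1" "parcs H = iso_arcs h ` parcs G1"
      "iso_tail h = fst" "iso_head h = snd"
    using arg_cong[OF H, of verts] arg_cong[OF H, of arcs]
      arg_cong[OF H, of tail] arg_cong[OF H, of head] by simp_all
  have "(?f u, ?f v) \<in> parcs G" if "(u, v) \<in> parcs G1" for u v
  proof -
    have "iso_arcs h (u, v) = (?f u, ?f v)"
      using iso that H_eqs by (force simp: pre_digraph.digraph_isomorphism_def prod_eq_iff)
    then have "(?f u, ?f v) \<in> parcs H"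
      using that H_eqs(2) by (metis imageI)
    then show ?thesis
      using sub by (auto simp: subgraph_def)
  qed
  moreover have "inj_on ?f (pverts G1)"
    using iso by (simp add: pre_digraph.digraph_isomorphism_def)
  moreover have "?f ` pverts G1 \<subseteq> pverts G"
    using sub H_eqs(1) by (simp add: subgraph_def)
  ultimately show "\<exists>f. inj_on f (pverts G1) \<and> f ` pverts G1 \<subseteq> pverts G \<and>
         (\<forall>u v. (u, v) \<in> parcs G1 \<longrightarrow> (f u, f v) \<in> parcs G)" by blast
next
  interpret G: pair_wf_digraph G by fact
  interpret G1: pair_wf_digraph G1 by fact
  assume "\<exists>f. inj_on f (pverts G1) \<and> f ` pverts G1 \<subseteq> pverts G \<and>
         (\<forall>u v. (u, v) \<in> parcs G1 \<longrightarrow> (f u, f v) \<in> parcs G)"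
  then obtain f where inj: "inj_on f (pverts G1)" and img: "f ` pverts G1 \<subseteq> pverts G"
    and hom: "\<And>u v. (u, v) \<in> parcs G1 \<Longrightarrow> (f u, f v) \<in> parcs G" by blast
  define H where "H = \<lparr> pverts = f ` pverts G1, parcs = map_prod f f ` parcs G1 \<rparr>"
  define h where "h = \<lparr> iso_verts = f, iso_arcs = map_prod f f, iso_head = snd, iso_tail = fst \<rparr>"
  have ends: "fst e \<in> pverts G1" "snd e \<in> pverts G1" if "e \<in> parcs G1" for e
    using that by (auto intro: G1.arc_fst_in_verts G1.arc_snd_in_verts)
  have "wf_digraph (with_proj H)"
    using ends by unfold_locales (force simp: H_def)+
  then have "subgraph (with_proj H) (with_proj G)"
    using img hom G.wf_digraph by (auto simp: subgraph_def compatible_def H_def)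
  moreover have "inj_on (map_prod f f) (parcs G1)"
    using map_prod_inj_on[OF inj inj] by (rule inj_on_subset) (use ends in force)
  then have "pre_digraph.digraph_isomorphism (with_proj G1) h"
    using inj G1.wf_digraph by (simp add: pre_digraph.digraph_isomorphism_def h_def)
  moreover have "with_proj H = app_iso h (with_proj G1)"
    by (simp add: app_iso_def with_proj_def H_def h_def)
  ultimately show "contains_subgraph G G1"
    unfolding contains_subgraph_def digraph_iso_def by blast
qed

lemma pair_graph_imp_pair_wf_digraph: "pair_graph G \<Longrightarrow> pair_wf_digraph G"
  by (simp add: pair_graph_def pair_digraph_def pair_fin_digraph_def)

lemma contains_subgraph_embeddingE:
  assumes "contains_subgraph G G1" and "pair_graph G" and "pair_graph G1"
  obtains f where "inj_on f (pverts G1)" and "f ` pverts G1 \<subseteq> pverts G"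
    and "\<And>u v. (u, v) \<in> parcs G1 \<Longrightarrow> (f u, f v) \<in> parcs G"
  using assms(1)
    contains_subgraph_iff_embedding[OF assms(2,3)[THEN pair_graph_imp_pair_wf_digraph]]
  by blast

lemma clique_contains_subgraph:
  assumes G: "pair_wf_digraph G" and G1: "pair_graph G1"
    and R: "R \<subseteq> pverts G" "finite R" "card R = card (pverts G1)"
    and clique: "\<And>u v. u \<in> R \<Longrightarrow> v \<in> R \<Longrightarrow> u \<noteq> v \<Longrightarrow> (u, v) \<in> parcs G"
  shows "contains_subgraph G G1"
proof -
  interpret G1: pair_graph G1 by fact
  obtain f where f: "bij_betw f (pverts G1) R"
    using R G1.pair_finite_verts finite_same_card_bij by metis
  have "(f u, f v) \<in> parcs G" if "(u, v) \<in> parcs G1" for u v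
  proof -
    have "u \<in> pverts G1" "v \<in> pverts G1" "u \<noteq> v"
      using that G1.arc_fst_in_verts G1.arc_snd_in_verts G1.pair_no_loops by fastforce+
    then show ?thesis
      using f clique by (metis bij_betw_apply bij_betw_inv_into_left)
  qed
  then show ?thesis
    using f R G pair_graph_imp_pair_wf_digraph[OF G1]
    by (auto simp: contains_subgraph_iff_embedding bij_betw_def)
qed

section \<open>Bounding Ramsey numbers from below\<close>

lemma ramsey_number_exists:
  assumes G1: "pair_graph G1" and G2: "pair_graph G2"
  shows "\<exists>n > 0. \<forall>G :: nat pair_pre_digraph. pair_graph G \<and> card (pverts G) = n \<longrightarrow>
           contains_subgraph G G1 \<or> contains_subgraph (graph_complement G) G2"
proof -
  obtain r where r: "r \<ge> 1 \<and> (\<forall>(V :: nat set) E. finite V \<and> card V \<ge> r \<longrightarrow>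
      (\<exists>R \<subseteq> V. card R = card (pverts G1) \<and> clique R E \<or> card R = card (pverts G2) \<and> indep R E))"
    using ramsey2[of "card (pverts G1)" "card (pverts G2)", where 'a = nat] by (rule exE)
  have "contains_subgraph G G1 \<or> contains_subgraph (graph_complement G) G2"
    if G: "pair_graph G" and card: "card (pverts G) = r" for G :: "nat pair_pre_digraph"
  proof -
    interpret G: pair_graph G by fact
    define E where "E = {{u, v} | u v. (u, v) \<in> parcs G}"
    have sym: "(u, v) \<in> parcs G \<longleftrightarrow> (v, u) \<in> parcs G" for u v
      using G.pair_sym_arcs by (auto simp: symmetric_def dest: symD)
    have E_iff: "{u, v} \<in> E \<longleftrightarrow> (u, v) \<in> parcs G" for u v
      using sym[of u v] by (auto simp: E_def doubleton_eq_iff)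
    obtain R where R: "R \<subseteq> pverts G"
      and alt: "card R = card (pverts G1) \<and> clique R E \<or> card R = card (pverts G2) \<and> indep R E"
      using r[THEN conjunct2, rule_format, of "pverts G" E] G.pair_finite_verts card by auto
    have "finite R"
      using R G.pair_finite_verts finite_subset by blast
    from alt show ?thesis
    proof
      assume *: "card R = card (pverts G1) \<and> clique R E"
      then have "(u, v) \<in> parcs G" if "u \<in> R" "v \<in> R" "u \<noteq> v" for u v
        using that E_iff unfolding clique_def by blast
      then show ?thesis
        using clique_contains_subgraph[OF pair_graph_imp_pair_wf_digraph[OF G] G1 R \<open>finite R\<close>] *
        by blast
    next
      assume *: "card R = card (pverts G2) \<and> indep R E"
      then have "(u, v) \<in> parcs (graph_complement G)" if "u \<in> R" "v \<in> R" "u \<noteq> v" for u v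
        using that E_iff R unfolding indep_def by (auto simp: graph_complement_def)
      moreover have "R \<subseteq> pverts (graph_complement G)"
        using R by (simp add: graph_complement_def)
      moreover note pair_graph_imp_pair_wf_digraph[OF pair_graph_graph_complement[OF G]]
      ultimately show ?thesis
        using clique_contains_subgraph[OF _ G2 _ \<open>finite R\<close>] * by blast
    qed
  qed
  then show ?thesis
    using r by (intro exI[of _ r]) auto
qed

lemma ramsey_number_greaterI:
  assumes G1: "pair_graph G1" and G2: "pair_graph G2"
    and avoid: "\<And>n. n \<le> N \<Longrightarrow> \<exists>G :: nat pair_pre_digraph. pair_graph G \<and> card (pverts G) = n \<and>
      \<not> contains_subgraph G G1 \<and> \<not> contains_subgraph (graph_complement G) G2"
  shows "N < ramsey_number G1 G2"
proof -
  have "\<forall>G :: nat pair_pre_digraph. pair_graph G \<and> card (pverts G) = ramsey_number G1 G2 \<longrightarrow>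
           contains_subgraph G G1 \<or> contains_subgraph (graph_complement G) G2"
    unfolding ramsey_number_def
    using LeastI_ex[OF ramsey_number_exists[OF G1 G2]] by blast
  then show ?thesis
    using avoid by (meson not_le)
qed

section \<open>Disjoint unions of cliques\<close>

text \<open>
  The blocks are the sets of numbers with a common quotient by \<open>m\<close>. Truncating at \<open>n\<close> gives an
  example of every smaller order as well, with the last block possibly incomplete.
\<close>

definition block_graph :: "nat \<Rightarrow> nat \<Rightarrow> nat pair_pre_digraph" where
  "block_graph m n =
     \<lparr> pverts = {..<n}, parcs = {(u, v). u < n \<and> v < n \<and> u \<noteq> v \<and> u div m = v div m} \<rparr>"

lemma pair_graph_block_graph: "pair_graph (block_graph m n)"
proof -
  have "parcs (block_graph m n) \<subseteq> {..<n} \<times> {..<n}"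
    by (auto simp: block_graph_def)
  then have "finite (parcs (block_graph m n))"
    by (meson finite_SigmaI finite_lessThan finite_subset)
  then show ?thesis
    by unfold_locales (auto simp: block_graph_def symmetric_def intro!: symI)
qed

text \<open>
  Having a vertex adjacent to all others is the form of connectedness used here: the image of that
  vertex determines the block that contains the whole image.
\<close>

lemma block_graph_avoids_dominated_graph:
  assumes G1: "pair_graph G1" and "0 < m" "m < card (pverts G1)"
    and c: "\<And>v. v \<in> pverts G1 \<Longrightarrow> v \<noteq> c \<Longrightarrow> (c, v) \<in> parcs G1"
  shows "\<not> contains_subgraph (block_graph m n) G1"
proof
  assume "contains_subgraph (block_graph m n) G1"
  then obtain f where inj: "inj_on f (pverts G1)"
    and hom: "\<And>u v. (u, v) \<in> parcs G1 \<Longrightarrow> (f u, f v) \<in> parcs (block_graph m n)"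
    using pair_graph_block_graph G1 by (rule contains_subgraph_embeddingE) (rule that)
  have "f v div m = f c div m" if "v \<in> pverts G1" for v
    using hom[OF c[OF that]] by (cases "v = c") (auto simp: block_graph_def)
  (* within one block the remainder modulo m identifies a vertex *)
  then have "inj_on (\<lambda>v. f v mod m) (pverts G1)"
    using inj by (intro inj_onI) (metis div_mult_mod_eq inj_onD)
  moreover have "(\<lambda>v. f v mod m) ` pverts G1 \<subseteq> {..<m}"
    using \<open>0 < m\<close> by auto
  ultimately have "card (pverts G1) \<le> card {..<m}"
    by (rule card_inj_on_le) simp
  then show False
    using \<open>m < card (pverts G1)\<close> by simp
qed

lemma block_graph_complement_avoids_graph_with_clique:
  assumes G2: "pair_graph G2" and "n \<le> m * b"
    and K: "K \<subseteq> pverts G2" "b < card K"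
      "\<And>u v. u \<in> K \<Longrightarrow> v \<in> K \<Longrightarrow> u \<noteq> v \<Longrightarrow> (u, v) \<in> parcs G2"
  shows "\<not> contains_subgraph (graph_complement (block_graph m n)) G2"
proof
  assume "contains_subgraph (graph_complement (block_graph m n)) G2"
  then obtain f where img: "f ` pverts G2 \<subseteq> pverts (graph_complement (block_graph m n))"
    and hom: "\<And>u v. (u, v) \<in> parcs G2 \<Longrightarrow>
      (f u, f v) \<in> parcs (graph_complement (block_graph m n))"
    using pair_graph_graph_complement[OF pair_graph_block_graph] G2
    by (rule contains_subgraph_embeddingE) (rule that)
  have "inj_on (\<lambda>v. f v div m) K"
    using hom[OF K(3)] by (fastforce simp: inj_on_def graph_complement_def block_graph_def)
  moreover have "(\<lambda>v. f v div m) ` K \<subseteq> {..<b}"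
  proof (intro image_subsetI)
    fix v assume "v \<in> K"
    then have "f v < b * m"
      using img K(1) \<open>n \<le> m * b\<close> by (force simp: graph_complement_def block_graph_def mult.commute)
    then show "f v div m \<in> {..<b}"
      by (simp add: less_mult_imp_div_less)
  qed
  ultimately have "card K \<le> card {..<b}"
    by (rule card_inj_on_le) simp
  then show False
    using \<open>b < card K\<close> by simp
qed

section \<open>The graphs \<open>F\<^sub>k\<close>\<close>

lemma F_graph_dominating_vertex:
  assumes "2 \<le> k" "v \<in> pverts (F_graph k)" "v \<noteq> 1"
  shows "(1, v) \<in> parcs (F_graph k)"
  using assms by (auto simp: F_graph_def F_edges_def)

text \<open>
  Of two distinct indices up to \<open>k div 2 + 1\<close>, the smaller one \<open>i\<close> is at most \<open>k div 2\<close>, and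
  \<open>k div 2 + 1 \<le> k + 1 - i\<close>, so the larger one lies in the range of neighbours of \<open>i\<close>.
\<close>

lemma F_graph_clique:
  assumes "u \<in> {1..k div 2 + 1}" "v \<in> {1..k div 2 + 1}" "u \<noteq> v"
  shows "(u, v) \<in> parcs (F_graph k)"
  using assms by (cases "u < v") (auto simp: F_graph_def F_edges_def)

theorem theorem2p2:
  fixes s t :: nat
  assumes "2 \<le> s" and "s \<le> t"
  shows "ramsey_number (F_graph s) (F_graph t) \<ge> 1 + (s - 1) * (t div 2)"
proof -
  have "(s - 1) * (t div 2) < ramsey_number (F_graph s) (F_graph t)"
  proof (rule ramsey_number_greaterI[OF pair_graph_F_graph pair_graph_F_graph])
    fix n assume n: "n \<le> (s - 1) * (t div 2)"
    let ?G = "block_graph (s - 1) n"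
    have "\<not> contains_subgraph ?G (F_graph s)"
    proof (rule block_graph_avoids_dominated_graph[OF pair_graph_F_graph])
      show "0 < s - 1" "s - 1 < card (pverts (F_graph s))"
        using assms by (auto simp: F_graph_def)
    qed (use F_graph_dominating_vertex assms in blast)
    moreover have "\<not> contains_subgraph (graph_complement ?G) (F_graph t)"
    proof (rule block_graph_complement_avoids_graph_with_clique[OF pair_graph_F_graph n])
      show "{1..t div 2 + 1} \<subseteq> pverts (F_graph t)" "t div 2 < card {1..t div 2 + 1}"
        using assms by (auto simp: F_graph_def)
    qed (rule F_graph_clique)
    ultimately show "\<exists>G :: nat pair_pre_digraph. pair_graph G \<and> card (pverts G) = n \<and>
        \<not> contains_subgraph G (F_graph s) \<and> \<not> contains_subgraph (graph_complement G) (F_graph t)"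
      using pair_graph_block_graph by (intro exI[of _ ?G]) (simp add: block_graph_def)
  qed
  then show ?thesis by simp
qed

end
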